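(* Let $a$ and $b$ be positive integers, and let $G$ be a finite simple graph of pathwidth less than $a$ that contains no path on $2^b$ vertices as a (not necessarily induced) subgraph. Then the treedepth of $G$ is at most $10ab$.
   Context: All graphs are finite and simple (no loops or parallel edges). Paths are subgraphs, not necessarily induced. Pathwidth: a path decomposition of a graph $G$ is a pair $(P,\{B_t\}_{t\in V(P)})$ where $P$ is a path (its vertices are called nodes) and each $B_t\subseteq V(G)$ is a set called a bag, such that (1) for every edge $uv\in E(G)$ there is a bag containing both $u$ and $v$, and (2) for every vertex $v\in V(G)$ the set of nodes $t$ with $v\in B_t$ induces a non-empty subpath of $P$. Its width is the maximum size of a bag minus $1$. The pathwidth $\operatorname{pw}(G)$ is the minimum width of a path decomposition of $G$. Treedepth: a rooted forest is a disjoint union of rooted trees; its height is the maximum number of vertices on a path from a root to a leaf. A vertex $u$ is an ancestor of a vertex $v$ in a rooted forest $F$ if $u$ lies on the unique path from a root to $v$ in $F$. A rooted forest $F$ is an elimination forest of $G$ if $V(F)=V(G)$ and for every edge $uv$ of $G$ one of $u,v$ is an ancestor of the other in $F$. The treedepth $\operatorname{td}(G)$ is the minimum height of an elimination forest of $G$. *)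

theory Defs
  imports "Graph_Theory.Graph_Theory"
begin

text \<open>
  Finite simple graphs are those of the locale \<open>graph\<close>: finite, loop-free symmetric digraphs without
  parallel arcs. An undirected edge \<open>uv\<close> is the pair of arcs \<open>(u, v)\<close>, \<open>(v, u)\<close> in \<open>arcs_ends G\<close>, and
  a path on \<open>n\<close> vertices is a list \<open>p\<close> of length \<open>n\<close> with \<open>vpath p G\<close>.
\<close>


text \<open>
  A path decomposition is the non-empty list of its bags in the order of the underlying path.
  The nodes are the positions in the list, so the non-empty subpaths are the integer intervals
  \<open>{i..j}\<close> with \<open>i \<le> j < length Bs\<close>.
\<close>

definition path_decomposition :: "('a, 'b) pre_digraph \<Rightarrow> 'a set list \<Rightarrow> bool" where
  "path_decomposition G Bs \<longleftrightarrow>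
     Bs \<noteq> [] \<and>
     (\<forall>B \<in> set Bs. B \<subseteq> verts G) \<and>
     (\<forall>(u, v) \<in> arcs_ends G. \<exists>B \<in> set Bs. u \<in> B \<and> v \<in> B) \<and>
     (\<forall>v \<in> verts G. \<exists>i j. i \<le> j \<and> j < length Bs \<and> {t. t < length Bs \<and> v \<in> Bs ! t} = {i..j})"

text \<open>Widths are integers: the graph without vertices has pathwidth \<open>-1\<close>.\<close>

definition width :: "'a set list \<Rightarrow> int" where
  "width Bs = int (Max (card ` set Bs)) - 1"

definition pathwidth :: "('a, 'b) pre_digraph \<Rightarrow> int" where
  "pathwidth G = (LEAST w. \<exists>Bs. path_decomposition G Bs \<and> width Bs = w)"


text \<open>
  A rooted forest is given with every edge oriented from the parent to the child. Its trees are the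
  weakly connected components, each rooted at its unique vertex of in-degree 0.
\<close>

definition rooted_forest :: "'a pair_pre_digraph \<Rightarrow> bool" where
  "rooted_forest F \<longleftrightarrow>
     pair_fin_digraph F \<and> acyclic (parcs F) \<and> (\<forall>v \<in> pverts F. in_degree (with_proj F) v \<le> 1)"

definition root :: "'a pair_pre_digraph \<Rightarrow> 'a \<Rightarrow> bool" where
  "root F v \<longleftrightarrow> v \<in> pverts F \<and> in_degree (with_proj F) v = 0"

definition leaf :: "'a pair_pre_digraph \<Rightarrow> 'a \<Rightarrow> bool" where
  "leaf F v \<longleftrightarrow> v \<in> pverts F \<and> out_degree (with_proj F) v = 0"

definition root_path :: "'a pair_pre_digraph \<Rightarrow> 'a list \<Rightarrow> 'a \<Rightarrow> bool" where
  "root_path F p v \<longleftrightarrow> vpath p (with_proj F) \<and> root F (hd p) \<and> last p = v"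

text \<open>Every vertex is an ancestor of itself.\<close>

definition ancestor :: "'a pair_pre_digraph \<Rightarrow> 'a \<Rightarrow> 'a \<Rightarrow> bool" where
  "ancestor F u v \<longleftrightarrow> (\<exists>p. root_path F p v \<and> u \<in> set p)"

text \<open>As \<open>Sup {} = 0\<close> on \<open>nat\<close>, the forest without vertices has height 0.\<close>

definition height :: "'a pair_pre_digraph \<Rightarrow> nat" where
  "height F = Sup {length p | p v. root_path F p v \<and> leaf F v}"

definition elimination_forest :: "('a, 'b) pre_digraph \<Rightarrow> 'a pair_pre_digraph \<Rightarrow> bool" where
  "elimination_forest G F \<longleftrightarrow>
     rooted_forest F \<and> pverts F = verts G \<and>
     (\<forall>(u, v) \<in> arcs_ends G. ancestor F u v \<or> ancestor F v u)"

definition treedepth :: "('a, 'b) pre_digraph \<Rightarrow> nat" where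
  "treedepth G = (LEAST h. \<exists>F. elimination_forest G F \<and> height F = h)"

end

theory Submission
  imports Defs
begin

text \<open>
  Order the vertices so that every initial segment \<open>P\<close> has at most \<open>a\<close> vertices with neighbours outside
  \<open>P\<close>; a path decomposition provides such an order (\<open>layout_if_path_decomposition\<close>). Removing
  the boundary of an initial segment splits the graph. Plain bisection therefore bounds the treedepth
  by \<open>a\<close> times the logarithm of the number of vertices, but this number is not bounded in terms of the
  longest path. The remedy is to cut only at boundaries that are cheap, and to measure progress along
  few disjoint paths, which together have fewer than \<open>a * 2 ^ b\<close> vertices.

  Why such paths exist: an order that minimises the sum of the boundary sizes is linked
  (\<open>min_cost_linked\<close>), by a submodularity argument. With Menger's theorem (\<open>menger\<close>), if all
  boundaries between two positions have size at least \<open>m\<close>, then \<open>m\<close> disjoint paths run between these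
  positions and meet all these boundaries (\<open>linkage_exists\<close>).

  Consider a piece between two positions whose boundaries have been removed, and let \<open>d\<close> vertices be
  common to these two boundaries. They also belong to all boundaries in between, so a cut at a boundary of size \<open>q\<close>
  costs only \<open>q - d\<close>. If \<open>m\<close> is the least size of a boundary inside the piece, call the boundaries of
  size at most \<open>2 * m - d\<close> cheap; a cheap cut costs at most \<open>2 * (m - d)\<close>. A binary search over the cheap
  positions, weighted by the vertices of \<open>m\<close> disjoint paths (\<open>eliminable_bisect\<close>), takes about
  \<open>log (a * 2 ^ b)\<close> rounds. It ends with pieces without cheap positions, and with pieces in which the
  \<open>m\<close> paths do not move, so that \<open>m\<close> vertices are common to the ends. In either case the sum of the
  number of common vertices and the least boundary size has grown by at least \<open>m - d\<close>, half of the
  price of one round. As this sum never exceeds \<open>2 * a\<close>, the total price is about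
  \<open>4 * a * log (a * 2 ^ b)\<close> (\<open>eliminable_piece\<close>).

  If \<open>10 * a * b < 2 ^ b\<close>, then \<open>log a < b\<close>, and the total is at most \<open>8 * a * b\<close>. If
  \<open>2 ^ b \<le> 10 * a * b\<close>, a depth-first search forest has height less than \<open>2 ^ b\<close>
  (\<open>eliminable_if_no_long_path\<close>), which is enough.
\<close>

section \<open>Menger's theorem\<close>

definition simple_path :: "('a \<times> 'a) set \<Rightarrow> 'a set \<Rightarrow> 'a list \<Rightarrow> bool" where
  "simple_path E V p \<longleftrightarrow>
     p \<noteq> [] \<and> distinct p \<and> set p \<subseteq> V \<and> successively (\<lambda>u v. (u, v) \<in> E) p"

lemma simple_path_mono:
  "simple_path E V p \<Longrightarrow> E \<subseteq> E' \<Longrightarrow> V \<subseteq> V' \<Longrightarrow> simple_path E' V' p"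
  unfolding simple_path_def by (auto elim: successively_mono)

text \<open>
  The arcs from \<open>B - A\<close> to \<open>A - B\<close> are unrestricted. Menger's theorem is proved for digraphs,
  because its induction removes one arc at a time and an undirected edge is two arcs.
\<close>

definition separation :: "('a \<times> 'a) set \<Rightarrow> 'a set \<Rightarrow> 'a set \<Rightarrow> 'a set \<Rightarrow> bool" where
  "separation E V A B \<longleftrightarrow> A \<union> B = V \<and> E \<inter> (A - B) \<times> (B - A) = {}"

definition disjoint_paths ::
    "('a \<times> 'a) set \<Rightarrow> 'a set \<Rightarrow> 'a set \<Rightarrow> 'a set \<Rightarrow> 'a set \<Rightarrow> ('a \<Rightarrow> 'a list) \<Rightarrow> bool" where
  "disjoint_paths E V S T I f \<longleftrightarrow>
     (\<forall>i\<in>I. simple_path E V (f i) \<and> hd (f i) \<in> S \<and> last (f i) \<in> T) \<and>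
     (\<forall>i\<in>I. \<forall>j\<in>I. i \<noteq> j \<longrightarrow> set (f i) \<inter> set (f j) = {})"

text \<open>
  As many disjoint paths into \<open>T\<close> as \<open>T\<close> has vertices end in each vertex of \<open>T\<close> exactly once, so
  they can be named after their ends. In this form two families are concatenated below.
\<close>

lemma disjoint_paths_index_by_ends:
  assumes "disjoint_paths E V S T I f" "finite I"
  shows "finite T \<Longrightarrow> card I = card T \<Longrightarrow>
           \<exists>g. disjoint_paths E V S T T g \<and> (\<forall>z\<in>T. last (g z) = z)"
    and "finite S \<Longrightarrow> card I = card S \<Longrightarrow>
           \<exists>g. disjoint_paths E V S T S g \<and> (\<forall>z\<in>S. hd (g z) = z)"
proof -
  have reindex: "\<exists>g. disjoint_paths E V S T Z g \<and> (\<forall>z\<in>Z. e (g z) = z)"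
    if Z: "finite Z" "card I = card Z" "e ` f ` I \<subseteq> Z" and e: "\<And>p. p \<noteq> [] \<Longrightarrow> e p \<in> set p"
    for Z and e :: "'a list \<Rightarrow> 'a"
  proof -
    have ne: "e (f i) \<in> set (f i)" if "i \<in> I" for i
      using assms(1) that e unfolding disjoint_paths_def simple_path_def by blast
    have "inj_on (\<lambda>i. e (f i)) I"
      using assms(1) ne unfolding inj_on_def disjoint_paths_def by (metis disjoint_iff)
    then have "(\<lambda>i. e (f i)) ` I = Z"
      using Z by (intro card_subset_eq) (auto simp: card_image)
    then have "\<forall>z\<in>Z. \<exists>i\<in>I. e (f i) = z"
      by auto
    then obtain h where h: "\<forall>z\<in>Z. h z \<in> I \<and> e (f (h z)) = z"
      by metis
    then have "disjoint_paths E V S T Z (f \<circ> h)"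
      using assms(1) unfolding disjoint_paths_def by (metis comp_apply)
    with h show ?thesis
      by (intro exI[of _ "f \<circ> h"]) auto
  qed
  show "finite T \<Longrightarrow> card I = card T \<Longrightarrow>
           \<exists>g. disjoint_paths E V S T T g \<and> (\<forall>z\<in>T. last (g z) = z)"
    using assms(1) by (intro reindex) (auto simp: disjoint_paths_def)
  show "finite S \<Longrightarrow> card I = card S \<Longrightarrow>
           \<exists>g. disjoint_paths E V S T S g \<and> (\<forall>z\<in>S. hd (g z) = z)"
    using assms(1) by (intro reindex) (auto simp: disjoint_paths_def)
qed

text \<open>
  Induction on the number of arcs. If deleting the arc \<open>(x, y)\<close> creates a separation \<open>(A, B)\<close> of
  order less than \<open>k\<close>, then the arc crosses it and the order is \<open>k - 1\<close>, since adding \<open>y\<close> to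
  \<open>A\<close> repairs it. Put \<open>X = A \<inter> B\<close>. Small separations of \<open>S\<close> from \<open>X + x\<close> within \<open>A\<close>, or of
  \<open>X + y\<close> from \<open>T\<close> within \<open>B\<close>, extend to small separations of the whole digraph; hence both sides
  have \<open>k\<close> disjoint paths by induction. They meet only in \<open>X\<close> and are joined there, the last
  pair by the arc \<open>(x, y)\<close>.
\<close>

theorem menger:
  assumes "finite E" "finite V" "S \<subseteq> V" "T \<subseteq> V"
    and "\<And>A B. separation E V A B \<Longrightarrow> S \<subseteq> A \<Longrightarrow> T \<subseteq> B \<Longrightarrow> k \<le> card (A \<inter> B)"
  shows "\<exists>I f. finite I \<and> card I = k \<and> disjoint_paths E V S T I f"
  using assms
proof (induction "card E" arbitrary: E V S T rule: less_induct)
  case less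
  note fin = less.prems(1,2) and sub = less.prems(3,4) and large = less.prems(5)
  show ?case
  proof (cases "E = {}")
    case True
    have "k \<le> card (S \<inter> (V - (S - T)))"
      using sub by (intro large) (auto simp: separation_def True)
    also have "S \<inter> (V - (S - T)) = S \<inter> T"
      using sub by auto
    finally obtain I where "I \<subseteq> S \<inter> T" "card I = k" "finite I"
      by (meson obtain_subset_with_card_n)
    then show ?thesis
      using sub by (intro exI[of _ I] exI[of _ "\<lambda>v. [v]"])
        (auto simp: disjoint_paths_def simple_path_def)
  next
    case False
    then obtain x y where xy: "(x, y) \<in> E"
      by auto
    define E' where "E' = E - {(x, y)}"
    have E': "card E' < card E" "finite E'" "E' \<subseteq> E"
      using card_Diff1_less[OF fin(1) xy] fin by (auto simp: E'_def)
    show ?thesis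
    proof (cases "\<forall>A B. separation E' V A B \<longrightarrow> S \<subseteq> A \<longrightarrow> T \<subseteq> B \<longrightarrow> k \<le> card (A \<inter> B)")
      case True
      then obtain I f where "finite I" "card I = k" "disjoint_paths E' V S T I f"
        using less.hyps[OF E'(1,2) fin(2) sub] by blast
      then show ?thesis
        using simple_path_mono[OF _ E'(3), of V _ V] unfolding disjoint_paths_def by blast
    next
      case False
      then obtain A B where AB: "separation E' V A B" "S \<subseteq> A" "T \<subseteq> B" "card (A \<inter> B) < k"
        by force
      have "\<not> separation E V A B"
        using large AB by fastforce
      then have x: "x \<in> A - B" and y: "y \<in> B - A"
        using AB(1) unfolding separation_def E'_def by auto
      have V: "A \<union> B = V" "finite A" "finite B"
        using AB(1) fin finite_subset unfolding separation_def by auto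
      define X where "X = A \<inter> B"
      have "separation E V (insert y A) B"
        using AB(1) y unfolding separation_def E'_def by auto
      then have "k \<le> card (insert y A \<inter> B)"
        using AB by (intro large) auto
      also have "insert y A \<inter> B = insert y X"
        using y by (auto simp: X_def)
      finally have cardX: "Suc (card X) = k"
        using AB(4) V y by (simp add: X_def)
      have left: "\<exists>I f. finite I \<and> card I = k \<and> disjoint_paths (E \<inter> A \<times> A) A S (insert x X) I f"
      proof (rule less.hyps)
        have "(x, y) \<notin> E \<inter> A \<times> A"
          using y by auto
        then show "card (E \<inter> A \<times> A) < card E"
          using fin xy by (intro psubset_card_mono) auto
        fix A' B'
        assume s: "separation (E \<inter> A \<times> A) A A' B'" "S \<subseteq> A'" "insert x X \<subseteq> B'"
        have "separation E V A' (B' \<union> B)"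
          using s(1,3) AB(1) V(1) unfolding separation_def X_def E'_def by blast
        then have "k \<le> card (A' \<inter> (B' \<union> B))"
          using s AB by (intro large) auto
        also have "A' \<inter> (B' \<union> B) = A' \<inter> B'"
          using s(1,3) unfolding separation_def X_def by blast
        finally show "k \<le> card (A' \<inter> B')" .
      qed (use AB V fin x in \<open>auto simp: X_def\<close>)
      have right: "\<exists>I f. finite I \<and> card I = k \<and> disjoint_paths (E \<inter> B \<times> B) B (insert y X) T I f"
      proof (rule less.hyps)
        have "(x, y) \<notin> E \<inter> B \<times> B"
          using x by auto
        then show "card (E \<inter> B \<times> B) < card E"
          using fin xy by (intro psubset_card_mono) auto
        fix A' B'
        assume s: "separation (E \<inter> B \<times> B) B A' B'" "insert y X \<subseteq> A'" "T \<subseteq> B'"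
        have "separation E V (A' \<union> A) B'"
          using s(1,2) AB(1) V(1) unfolding separation_def X_def E'_def by blast
        then have "k \<le> card ((A' \<union> A) \<inter> B')"
          using s AB by (intro large) auto
        also have "(A' \<union> A) \<inter> B' = A' \<inter> B'"
          using s(1,2) unfolding separation_def X_def by blast
        finally show "k \<le> card (A' \<inter> B')" .
      qed (use AB V fin y in \<open>auto simp: X_def\<close>)
      have cards: "finite X" "card (insert x X) = k" "card (insert y X) = k"
        using cardX V x y by (auto simp: X_def)
      obtain p where p: "disjoint_paths (E \<inter> A \<times> A) A S (insert x X) (insert x X) p"
          "\<And>z. z \<in> insert x X \<Longrightarrow> last (p z) = z"
        using left disjoint_paths_index_by_ends(1) cards by (metis finite_insert)
      obtain q where q: "disjoint_paths (E \<inter> B \<times> B) B (insert y X) T (insert y X) q"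
          "\<And>z. z \<in> insert y X \<Longrightarrow> hd (q z) = z"
        using right disjoint_paths_index_by_ends(2) cards by (metis finite_insert)
      \<comment> \<open>The path ending in \<open>z\<close> is continued by the path starting in \<open>n z\<close>.\<close>
      define n where "n z = (if z = x then y else z)" for z
      have n: "n z \<in> insert y X" "inj_on n (insert x X)" if "z \<in> insert x X" for z
        using that y x by (auto simp: n_def X_def inj_on_def)
      define r where "r z = p z @ (if z = x then q y else tl (q z))" for z
      have p1: "simple_path (E \<inter> A \<times> A) A (p z)" "hd (p z) \<in> S" "last (p z) = z"
        if "z \<in> insert x X" for z
        using p that unfolding disjoint_paths_def by auto
      have q1: "simple_path (E \<inter> B \<times> B) B (q (n z))" "hd (q (n z)) = n z" "last (q (n z)) \<in> T"
        if "z \<in> insert x X" for z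
        using q n[OF that] unfolding disjoint_paths_def by auto
      have pX: "set (p z) \<inter> insert x X = {z}" if z: "z \<in> insert x X" for z
      proof -
        have "w = z" if "w \<in> set (p z)" "w \<in> insert x X" for w
        proof (rule ccontr)
          assume "w \<noteq> z"
          then have "set (p w) \<inter> set (p z) = {}"
            using p(1) that z unfolding disjoint_paths_def by blast
          moreover have "w \<in> set (p w)"
            using p1[OF that(2)] unfolding simple_path_def by (metis last_in_set)
          ultimately show False
            using that by auto
        qed
        moreover have "z \<in> set (p z)"
          using p1[OF z] unfolding simple_path_def by (metis last_in_set)
        ultimately show ?thesis
          using z by auto
      qed
      have qX: "set (q z) \<inter> insert y X = {z}" if z: "z \<in> insert y X" for z
      proof -
        have hdq: "u \<in> set (q u)" if "u \<in> insert y X" for u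
          using q that unfolding simple_path_def disjoint_paths_def by (metis hd_in_set)
        have "w = z" if "w \<in> set (q z)" "w \<in> insert y X" for w
        proof (rule ccontr)
          assume "w \<noteq> z"
          then have "set (q w) \<inter> set (q z) = {}"
            using q(1) that z unfolding disjoint_paths_def by blast
          then show False
            using that hdq by auto
        qed
        then show ?thesis
          using z hdq by auto
      qed
      have pq: "set (p z) \<inter> set (q (n z')) \<subseteq> {z} \<inter> {n z'}"
        if z: "z \<in> insert x X" "z' \<in> insert x X" for z z'
      proof -
        have "set (p z) \<inter> set (q (n z')) \<subseteq> X"
          using p1(1)[OF z(1)] q1(1)[OF z(2)] unfolding simple_path_def X_def by auto
        then show ?thesis
          using pX[OF z(1)] qX[OF n(1)[OF z(2)]] by auto
      qed
      have set_r: "set (r z) \<subseteq> set (p z) \<union> set (q (n z))" for z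
        unfolding r_def n_def by (cases "q z") auto
      have "simple_path E V (r z) \<and> hd (r z) \<in> S \<and> last (r z) \<in> T"
        if z: "z \<in> insert x X" for z
      proof (cases "z = x")
        case True
        have "set (p x) \<inter> set (q y) = {}"
          using pq[OF z z] y True x by (auto simp: n_def)
        then show ?thesis
          using p1[OF z] q1[OF z] True xy V(1)
          by (auto simp: simple_path_def r_def n_def successively_append_iff elim!: successively_mono)
      next
        case False
        then obtain q' where q': "q z = z # q'"
          using q1[OF z] unfolding simple_path_def n_def by (metis list.collapse)
        have "set (p z) \<inter> set q' = {}"
          using pq[OF z z] q1(1)[OF z] False q' by (auto simp: n_def simple_path_def)
        then show ?thesis
          using p1[OF z] q1[OF z] False V(1) q'
          by (auto simp: simple_path_def r_def n_def successively_append_iff successively_Cons last_append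
              elim!: successively_mono)
      qed
      moreover have "set (r z) \<inter> set (r z') = {}"
        if z: "z \<in> insert x X" "z' \<in> insert x X" and "z \<noteq> z'" for z z'
      proof -
        have "set (p z) \<inter> set (p z') = {}"
          using p(1) that unfolding disjoint_paths_def by blast
        moreover have "n z \<noteq> n z'"
          using inj_onD[OF n(2)[OF z(1)] _ z] that by blast
        then have "set (q (n z)) \<inter> set (q (n z')) = {}"
          using q(1) n(1) z unfolding disjoint_paths_def by blast
        moreover have "n z \<noteq> z'" "n z' \<noteq> z"
          using that x y by (auto simp: n_def X_def)
        ultimately show ?thesis
          using pq[OF z] pq[OF z(2,1)] set_r[of z] set_r[of z'] by blast
      qed
      ultimately show ?thesis
        using cards by (intro exI[of _ "insert x X"] exI[of _ r]) (auto simp: disjoint_paths_def)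
    qed
  qed
qed

section \<open>Linked layouts\<close>

text \<open>
  The boundary of \<open>P\<close> is the separator \<open>P \<inter> R\<close> of the separation of \<open>P\<close> from
  \<open>R = (V - P) \<union> boundary E P\<close>. It plays the role of a bag.
\<close>

definition boundary :: "('a \<times> 'a) set \<Rightarrow> 'a set \<Rightarrow> 'a set" where
  "boundary E P = {u \<in> P. \<exists>v. v \<notin> P \<and> (u, v) \<in> E}"

lemma boundary_subset: "boundary E P \<subseteq> P"
  by (auto simp: boundary_def)

lemma card_boundary_submodular:
  assumes "finite P" "finite Q"
  shows "card (boundary E (P \<inter> Q)) + card (boundary E (P \<union> Q))
           \<le> card (boundary E P) + card (boundary E Q)"
proof -
  have fin: "finite (boundary E R)" if "R \<subseteq> P \<union> Q" for R
    using assms that finite_subset boundary_subset by (metis finite_UnI)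
  have "card (boundary E (P \<inter> Q)) + card (boundary E (P \<union> Q))
      = card (boundary E (P \<inter> Q) \<union> boundary E (P \<union> Q))
        + card (boundary E (P \<inter> Q) \<inter> boundary E (P \<union> Q))"
    by (intro card_Un_Int fin) auto
  also have "\<dots> \<le> card (boundary E P \<union> boundary E Q) + card (boundary E P \<inter> boundary E Q)"
    using fin[of P] fin[of Q] by (intro add_mono card_mono) (auto simp: boundary_def)
  also have "\<dots> = card (boundary E P) + card (boundary E Q)"
    using fin[of P] fin[of Q] by (intro card_Un_Int[symmetric]) auto
  finally show ?thesis .
qed

locale finite_graph =
  fixes E :: "('a \<times> 'a) set" and V :: "'a set"
  assumes finite_V: "finite V" and E_subset: "E \<subseteq> V \<times> V" and sym_E: "sym E"
begin

abbreviation bd :: "'a set \<Rightarrow> 'a set" where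
  "bd \<equiv> boundary E"

definition below :: "('a \<Rightarrow> nat) \<Rightarrow> nat \<Rightarrow> 'a set" where
  "below pos l = {v \<in> V. pos v \<le> l}"

lemma below_subset: "below pos l \<subseteq> V"
  and below_mono: "l \<le> m \<Longrightarrow> below pos l \<subseteq> below pos m"
  by (auto simp: below_def)

lemma finite_below [simp]: "finite (below pos l)" "finite (bd (below pos l))"
proof -
  show "finite (below pos l)"
    by (rule finite_subset[OF below_subset finite_V])
  then show "finite (bd (below pos l))"
    by (rule finite_subset[OF boundary_subset])
qed

text \<open>
  Linear layouts replace path decompositions. The bags are the boundaries of the initial segments
  \<open>below pos l\<close>, and the condition that a vertex occupies an interval of bags holds by itself. The
  positions need not be consecutive, which lets a layout be rearranged by shifting positions.
  They are positive in order that \<open>below pos 0\<close> is empty.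
\<close>

definition layout :: "nat \<Rightarrow> ('a \<Rightarrow> nat) \<Rightarrow> bool" where
  "layout a pos \<longleftrightarrow> inj_on pos V \<and> (\<forall>v\<in>V. 0 < pos v) \<and> (\<forall>v\<in>V. card (bd (below pos (pos v))) \<le> a)"

definition cost :: "('a \<Rightarrow> nat) \<Rightarrow> nat" where
  "cost pos = (\<Sum>v\<in>V. card (bd (below pos (pos v))))"

text \<open>
  Initial segments change only at positions of vertices; hence bounds at those positions, as in
  \<open>layout\<close>, are bounds everywhere.
\<close>

lemma below_at_vertex:
  "below pos l = {} \<or> (\<exists>v\<in>V. pos v \<le> l \<and> below pos l = below pos (pos v))"
proof (cases "below pos l = {}")
  case False
  define m where "m = Max (pos ` below pos l)"
  have "m \<in> pos ` below pos l"
    using False unfolding m_def by (intro Max_in) auto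
  then obtain v where v: "v \<in> below pos l" "pos v = m"
    by auto
  have "pos u \<le> m" if "u \<in> below pos l" for u
    using that unfolding m_def by (intro Max_ge) auto
  then have "below pos l = below pos (pos v)"
    using v by (auto simp: below_def)
  moreover have "v \<in> V" "pos v \<le> l"
    using v(1) by (auto simp: below_def)
  ultimately show ?thesis
    by (intro disjI2 bexI[of _ v] conjI)
qed simp

lemma layout_card_le: "layout a pos \<Longrightarrow> card (bd (below pos l)) \<le> a"
proof -
  assume lay: "layout a pos"
  consider "below pos l = {}" | v where "v \<in> V" "below pos l = below pos (pos v)"
    using below_at_vertex[of pos l] by metis
  then show ?thesis
  proof cases
    case 1
    then show ?thesis
      by (simp only: 1) (simp add: boundary_def)
  next
    case 2
    then show ?thesis
      using lay unfolding layout_def by (simp only: 2)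
  qed
qed

text \<open>
  With Menger's theorem this says that as many disjoint paths run between two initial
  segments as the smallest boundary between them permits.
\<close>

definition linked :: "('a \<Rightarrow> nat) \<Rightarrow> bool" where
  "linked pos \<longleftrightarrow> (\<forall>i j k Z. (\<forall>l\<in>{i..j}. k \<le> card (bd (below pos l))) \<and> i \<le> j \<and>
     below pos i \<subseteq> Z \<and> Z \<subseteq> below pos j \<longrightarrow> k \<le> card (bd Z))"

text \<open>
  Suppose that some \<open>Z\<close> between two initial segments has a smaller boundary than all initial
  segments between them, and let \<open>Z\<close> have the smallest boundary possible. Rearrange the layout so
  that all of \<open>Z\<close> precedes all of \<open>V - Z\<close>, each part in its old order. The new initial segments are
  \<open>Z \<inter> P\<close> or \<open>Z \<union> P\<close> for old ones \<open>P\<close>, and submodularity together with the choice of \<open>Z\<close> shows that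
  no boundary grows. At the last vertex of \<open>Z\<close> the new initial segment is \<open>Z\<close> itself, where the
  boundary shrinks. So the total cost decreases.
\<close>

lemma min_cost_linked:
  assumes lay: "layout a pos"
    and min: "\<And>pos'. layout a pos' \<Longrightarrow> cost pos \<le> cost pos'"
  shows "linked pos"
proof (rule ccontr)
  assume "\<not> linked pos"
  then obtain i j k Z0 where k: "\<forall>l\<in>{i..j}. k \<le> card (bd (below pos l))" "i \<le> j"
    and Z0: "below pos i \<subseteq> Z0" "Z0 \<subseteq> below pos j" "\<not> k \<le> card (bd Z0)"
    unfolding linked_def by blast
  define between where "between Z \<longleftrightarrow> below pos i \<subseteq> Z \<and> Z \<subseteq> below pos j" for Z
  obtain Z where Z: "between Z" and Z_min: "\<And>Y. between Y \<Longrightarrow> card (bd Z) \<le> card (bd Y)"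
    using ex_has_least_nat[of between Z0 "\<lambda>Z. card (bd Z)"] Z0 unfolding between_def by auto
  have Zk: "card (bd Z) < k"
    using Z_min[of Z0] Z0 by (auto simp: between_def)
  have ZV: "Z \<subseteq> V" "finite Z"
    using Z finite_V finite_subset below_subset unfolding between_def by (metis order_trans)+
  note submod = card_boundary_submodular[OF ZV(2) finite_below(1)[of pos], of E]
  have in_Z: "card (bd (Z \<inter> below pos (pos v))) \<le> card (bd (below pos (pos v)))" if "v \<in> Z" for v
  proof -
    have "between (Z \<union> below pos (pos v))"
      using Z that unfolding between_def by (auto simp: below_def)
    then show ?thesis
      using Z_min submod[of "pos v"] by force
  qed
  have off_Z: "card (bd (Z \<union> below pos (pos v))) \<le> card (bd (below pos (pos v)))"
    if "v \<in> V" "v \<notin> Z" for v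
  proof -
    have "between (Z \<inter> below pos (pos v))"
      using Z that unfolding between_def by (auto simp: below_def)
    then show ?thesis
      using Z_min submod[of "pos v"] by force
  qed
  define N where "N = Suc (Max (insert 0 (pos ` V)))"
  have N: "pos v < N" if "v \<in> V" for v
    using finite_V that unfolding N_def by (intro le_imp_less_Suc Max_ge) auto
  define pos' where "pos' v = (if v \<in> Z then pos v else pos v + N)" for v
  have below': "below pos' (pos' v) = (if v \<in> Z then Z \<inter> below pos (pos v) else Z \<union> below pos (pos v))"
    if "v \<in> V" for v
  proof (rule set_eqI)
    fix u
    show "u \<in> below pos' (pos' v) \<longleftrightarrow>
        u \<in> (if v \<in> Z then Z \<inter> below pos (pos v) else Z \<union> below pos (pos v))"
      using N[of u] N[OF that] ZV that
      by (cases "u \<in> Z"; cases "v \<in> Z"; cases "u \<in> V") (auto simp: below_def pos'_def)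
  qed
  have le: "card (bd (below pos' (pos' v))) \<le> card (bd (below pos (pos v)))" if "v \<in> V" for v
    using that in_Z off_Z by (auto simp: below')
  have lay': "layout a pos'"
    unfolding layout_def
  proof (intro conjI ballI)
    show "inj_on pos' V"
    proof (rule inj_onI)
      fix u v assume "u \<in> V" "v \<in> V" "pos' u = pos' v"
      then show "u = v"
        using N[of u] N[of v] inj_onD[of pos V u v] lay
        by (cases "u \<in> Z"; cases "v \<in> Z") (auto simp: pos'_def layout_def)
    qed
  next
    fix v assume "v \<in> V"
    then show "0 < pos' v"
      using lay by (auto simp: layout_def pos'_def)
  next
    fix v assume "v \<in> V"
    then show "card (bd (below pos' (pos' v))) \<le> a"
      using le lay unfolding layout_def by (meson le_trans)
  qed
  have "Z \<noteq> below pos i"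
    using bspec[OF k(1), of i] k(2) Zk by auto
  then obtain u where u: "u \<in> Z" "u \<notin> below pos i"
    using Z by (auto simp: between_def)
  define m where "m = Max (pos ` Z)"
  have "m \<in> pos ` Z"
    unfolding m_def using u ZV by (intro Max_in) auto
  then obtain v where v: "v \<in> Z" "pos v = m"
    by auto
  have m: "pos w \<le> m" if "w \<in> Z" for w
    using that ZV unfolding m_def by (intro Max_ge) auto
  have "m \<in> {i..j}"
    using u v m[OF u(1)] Z ZV unfolding between_def below_def by auto
  moreover have "Z \<inter> below pos (pos v) = Z"
    using m v ZV by (auto simp: below_def)
  ultimately have "card (bd (below pos' (pos' v))) < card (bd (below pos (pos v)))"
    using v ZV bspec[OF k(1), of m] Zk below'[of v] by auto
  then have "cost pos' < cost pos"
    unfolding cost_def using finite_V le v ZV by (intro sum_strict_mono_ex1) auto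
  then show False
    using min[OF lay'] by simp
qed

lemma linked_layout_exists:
  assumes "layout a pos"
  shows "\<exists>pos. layout a pos \<and> linked pos"
  using ex_has_least_nat[of "layout a" pos cost] assms min_cost_linked by blast

text \<open>
  The last vertex before the path first leaves \<open>P\<close> lies in the boundary of \<open>P\<close>; if the path never
  leaves \<open>P\<close>, its end does.
\<close>

lemma path_meets_boundary:
  assumes "simple_path E V p" "hd p \<in> P" "last p \<in> P \<Longrightarrow> last p \<in> bd P"
  shows "set p \<inter> bd P \<noteq> {}"
  using assms
proof (induction p)
  case (Cons x p)
  show ?case
  proof (cases "p = []")
    case False
    then have p: "simple_path E V p" "(x, hd p) \<in> E"
      using Cons.prems(1) by (auto simp: simple_path_def successively_Cons)
    show ?thesis
    proof (cases "hd p \<in> P")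
      case True
      then show ?thesis
        using Cons.IH p Cons.prems False by auto
    next
      case out: False
      then show ?thesis
        using p Cons.prems by (auto simp: boundary_def)
    qed
  qed (use Cons.prems in auto)
qed (simp add: simple_path_def)

text \<open>
  The set \<open>L\<close> consists of the vertices on \<open>k\<close> disjoint paths from \<open>below pos i\<close> to the far side of
  \<open>below pos j\<close>. Each path crosses every boundary in between. What matters later is that \<open>L\<close> is
  small and still fills at least \<open>k\<close> places of each of these boundaries.
\<close>

lemma linkage_exists:
  assumes linked: "linked pos" and ij: "i \<le> j"
    and k: "\<And>l. l \<in> {i..j} \<Longrightarrow> k \<le> card (bd (below pos l))"
    and short: "\<And>p. simple_path E V p \<Longrightarrow> length p \<le> n"
  shows "\<exists>L \<subseteq> V. card L \<le> k * n \<and> (\<forall>l\<in>{i..j}. k \<le> card (L \<inter> bd (below pos l)))"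
proof -
  define R where "R = (V - below pos j) \<union> bd (below pos j)"
  have RV: "R \<subseteq> V"
    using below_subset boundary_subset unfolding R_def by (metis Diff_subset Un_least order_trans)
  have "\<exists>I f. finite I \<and> card I = k \<and> disjoint_paths E V (below pos i) R I f"
  proof (rule menger)
    show "finite E"
      using E_subset finite_V finite_subset by auto
    fix A B
    assume s: "separation E V A B" "below pos i \<subseteq> A" "R \<subseteq> B"
    have "k \<le> card (bd (A \<inter> below pos j))"
      using linked ij k s(2) below_mono[OF ij] unfolding linked_def
      by (metis Int_lower2 le_inf_iff)
    also have "bd (A \<inter> below pos j) \<subseteq> A \<inter> B"
    proof
      fix u assume "u \<in> bd (A \<inter> below pos j)"
      then obtain w where u: "u \<in> A" "u \<in> below pos j" and w: "w \<notin> A \<inter> below pos j" "(u, w) \<in> E"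
        by (auto simp: boundary_def)
      have "u \<in> B"
      proof (cases "w \<in> A")
        case True
        then have "u \<in> bd (below pos j)"
          using u w by (auto simp: boundary_def)
        then show ?thesis
          using s(3) by (auto simp: R_def)
      next
        case False
        then show ?thesis
          using s(1) u(1) w(2) E_subset by (auto simp: separation_def)
      qed
      then show "u \<in> A \<inter> B"
        using u by simp
    qed
    then have "card (bd (A \<inter> below pos j)) \<le> card (A \<inter> B)"
      using s(1) finite_V by (intro card_mono) (auto simp: separation_def)
    finally show "k \<le> card (A \<inter> B)" .
  qed (use finite_V below_subset RV in auto)
  then obtain I f where I: "finite I" "card I = k"
    and f: "disjoint_paths E V (below pos i) R I f"
    by auto
  define L where "L = (\<Union>q\<in>I. set (f q))"
  have paths: "simple_path E V (f q)" "hd (f q) \<in> below pos i" "last (f q) \<in> R" if "q \<in> I" for q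
    using f that unfolding disjoint_paths_def by auto
  have "L \<subseteq> V"
    using paths unfolding L_def simple_path_def by blast
  moreover have "card L \<le> k * n"
  proof -
    have "card L \<le> (\<Sum>q\<in>I. card (set (f q)))"
      unfolding L_def by (rule card_UN_le[OF I(1)])
    also have "\<dots> \<le> (\<Sum>q\<in>I. n)"
      using paths short by (intro sum_mono) (meson card_length order_trans)
    finally show ?thesis
      using I by simp
  qed
  moreover have "k \<le> card (L \<inter> bd (below pos l))" if l: "l \<in> {i..j}" for l
  proof -
    have "\<exists>v. v \<in> set (f q) \<inter> bd (below pos l)" if q: "q \<in> I" for q
    proof -
      have "set (f q) \<inter> bd (below pos l) \<noteq> {}"
      proof (rule path_meets_boundary[OF paths(1)[OF q]])
        show "hd (f q) \<in> below pos l"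
          using paths(2)[OF q] below_mono[of i l pos] l by auto
        assume "last (f q) \<in> below pos l"
        then show "last (f q) \<in> bd (below pos l)"
          using paths(3)[OF q] below_mono[of l j pos] l unfolding R_def boundary_def by auto
      qed
      then show ?thesis
        by auto
    qed
    then obtain g where g: "\<And>q. q \<in> I \<Longrightarrow> g q \<in> set (f q) \<inter> bd (below pos l)"
      by metis
    have "inj_on g I"
    proof (rule inj_onI, rule ccontr)
      fix q r assume "q \<in> I" "r \<in> I" "g q = g r" "q \<noteq> r"
      then show False
        using g[of q] g[of r] f unfolding disjoint_paths_def by fastforce
    qed
    then have "k = card (g ` I)"
      using I by (simp add: card_image)
    also have "\<dots> \<le> card (L \<inter> bd (below pos l))"
      using g unfolding L_def by (intro card_mono) auto
    finally show ?thesis .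
  qed
  ultimately show ?thesis
    by blast
qed

end

section \<open>Elimination\<close>

text \<open>
  Treedepth at most \<open>h\<close> of the subgraph induced by a vertex set, in its recursive form: a vertex is
  removed at the price of one level, and parts without edges between them are treated side by side.
\<close>

inductive eliminable :: "('a \<times> 'a) set \<Rightarrow> 'a set \<Rightarrow> nat \<Rightarrow> bool" for E where
  empty: "eliminable E {} h"
| remove: "v \<in> U \<Longrightarrow> eliminable E (U - {v}) h \<Longrightarrow> eliminable E U (Suc h)"
| disjoint_union: "eliminable E U h \<Longrightarrow> eliminable E W h \<Longrightarrow> U \<inter> W = {} \<Longrightarrow>
    E \<inter> U \<times> W = {} \<Longrightarrow> E \<inter> W \<times> U = {} \<Longrightarrow> eliminable E (U \<union> W) h"

lemma eliminable_mono: "eliminable E U h \<Longrightarrow> h \<le> h' \<Longrightarrow> eliminable E U h'"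
proof (induction arbitrary: h' rule: eliminable.induct)
  case (remove v U h)
  then obtain h'' where "h' = Suc h''" "h \<le> h''"
    by (cases h') auto
  then show ?case
    using remove by (auto intro: eliminable.remove)
qed (auto intro: eliminable.intros)

lemma eliminable_subset: "eliminable E U h \<Longrightarrow> W \<subseteq> U \<Longrightarrow> eliminable E W h"
proof (induction arbitrary: W rule: eliminable.induct)
  case (remove v U h)
  show ?case
  proof (cases "v \<in> W")
    case True
    have "eliminable E (W - {v}) h"
      using remove by blast
    with True show ?thesis
      by (rule eliminable.remove)
  next
    case False
    then have "eliminable E W h"
      using remove by blast
    then show ?thesis
      by (rule eliminable_mono) simp
  qed
next
  case (disjoint_union U h U')
  have "eliminable E ((W \<inter> U) \<union> (W \<inter> U')) h"
    using disjoint_union by (intro eliminable.disjoint_union) auto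
  then show ?case
    using disjoint_union.prems by (simp add: Int_Un_distrib[symmetric] Int_absorb2)
qed (auto intro: eliminable.empty)

lemma eliminable_remove_set:
  "finite X \<Longrightarrow> eliminable E (U - X) h \<Longrightarrow> eliminable E U (h + card X)"
proof (induction X arbitrary: h rule: finite_induct)
  case (insert x X)
  have "eliminable E (U - X) (Suc h)"
  proof (cases "x \<in> U - X")
    case True
    moreover have "eliminable E (U - X - {x}) h"
      using insert.prems by (simp only: Diff_insert[symmetric])
    ultimately show ?thesis
      by (rule eliminable.remove)
  next
    case False
    then have "U - X = U - insert x X"
      by auto
    then show ?thesis
      using insert.prems by (metis eliminable_mono le_SucI order_refl)
  qed
  then show ?case
    using insert by fastforce
qed simp

text \<open>
  Depth-first search. The vertex \<open>w\<close> serves as root of the component of \<open>u\<close>. Once \<open>w\<close> is removed,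
  every component of the rest of its component contains a neighbour of \<open>w\<close>, and paths starting
  there are shorter by one because they can be prolonged by \<open>w\<close>. Demanding a root for each vertex,
  instead of connectedness, makes the statement pass to subsets in the induction.
\<close>

lemma eliminable_if_no_long_path:
  assumes "finite U" "sym E"
    and "\<And>u. u \<in> U \<Longrightarrow> \<exists>w\<in>U. (w, u) \<in> (E \<inter> U \<times> U)\<^sup>* \<and>
           (\<forall>p. simple_path E U p \<longrightarrow> hd p = w \<longrightarrow> length p \<le> h)"
  shows "eliminable E U h"
  using assms(1,3)
proof (induction "card U" arbitrary: U h rule: less_induct)
  case less
  show ?case
  proof (cases "U = {}")
    case False
    then obtain w where w: "w \<in> U" "\<And>p. simple_path E U p \<Longrightarrow> hd p = w \<Longrightarrow> length p \<le> h"
      using less.prems(2) by blast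
    define R where "R = E \<inter> U \<times> U"
    define C where "C = {v. (w, v) \<in> R\<^sup>*}"
    have R_closed: "v \<in> C" if "u \<in> C" "(u, v) \<in> R" for u v
      using that unfolding C_def by (auto intro: rtrancl_into_rtrancl)
    have "C \<subseteq> U"
    proof
      fix v assume "v \<in> C"
      then have "(w, v) \<in> R\<^sup>*"
        by (simp add: C_def)
      then show "v \<in> U"
        using w(1) by (induction rule: rtrancl_induct) (auto simp: R_def)
    qed
    have "w \<in> C"
      by (simp add: C_def)
    show ?thesis
    proof (cases "C = U")
      case True
      have "simple_path E U [w]"
        using w(1) by (simp add: simple_path_def)
      then obtain h' where h': "h = Suc h'"
        using w(2)[of "[w]"] by (cases h) auto
      have "eliminable E (U - {w}) h'"
      proof (rule less.hyps)
        show "card (U - {w}) < card U"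
          using less.prems(1) w(1) by (rule card_Diff1_less)
        fix u assume u: "u \<in> U - {w}"
        define R' where "R' = E \<inter> (U - {w}) \<times> (U - {w})"
        have "(w, u) \<in> R\<^sup>*"
          using u True by (auto simp: C_def)
        then have "u = w \<or> (\<exists>w'. (w, w') \<in> R \<and> w' \<noteq> w \<and> (w', u) \<in> R'\<^sup>*)"
        proof (induction rule: rtrancl_induct)
          case (step v v')
          show ?case
          proof (cases "v = w \<or> v' = w")
            case True
            then show ?thesis
              using step by blast
          next
            case False
            then have "(v, v') \<in> R'"
              using step.hyps(2) by (auto simp: R_def R'_def)
            then show ?thesis
              using step.IH False by (meson rtrancl_into_rtrancl)
          qed
        qed simp
        then obtain w' where w': "(w, w') \<in> R" "w' \<noteq> w" "(w', u) \<in> R'\<^sup>*"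
          using u by auto
        have "length p \<le> h'" if p: "simple_path E (U - {w}) p" "hd p = w'" for p
        proof -
          have "simple_path E U (w # p)"
            using p w' w(1) by (auto simp: simple_path_def successively_Cons R_def)
          then show ?thesis
            using w(2)[of "w # p"] h' by simp
        qed
        then show "\<exists>w'\<in>U - {w}. (w', u) \<in> (E \<inter> (U - {w}) \<times> (U - {w}))\<^sup>* \<and>
            (\<forall>p. simple_path E (U - {w}) p \<longrightarrow> hd p = w' \<longrightarrow> length p \<le> h')"
          using w' unfolding R_def R'_def by blast
      qed (use less.prems(1) in auto)
      then show ?thesis
        unfolding h' by (rule eliminable.remove[OF w(1)])
    next
      case False
      have "eliminable E C h"
      proof (rule less.hyps)
        show "card C < card U"
          using \<open>C \<subseteq> U\<close> False less.prems(1) by (intro psubset_card_mono) auto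
        show "finite C"
          using \<open>C \<subseteq> U\<close> less.prems(1) by (rule finite_subset)
        fix u assume "u \<in> C"
        then have "(w, u) \<in> R\<^sup>*"
          by (simp add: C_def)
        then have "(w, u) \<in> (E \<inter> C \<times> C)\<^sup>* \<and> u \<in> C"
        proof (induction rule: rtrancl_induct)
          case (step v v')
          then have "(v, v') \<in> E \<inter> C \<times> C"
            using R_closed[of v v'] by (auto simp: R_def)
          then show ?case
            using step.IH by (auto intro: rtrancl_into_rtrancl)
        qed (simp add: \<open>w \<in> C\<close>)
        moreover have "length p \<le> h" if "simple_path E C p" "hd p = w" for p
          using w(2)[of p] that simple_path_mono[OF that(1) order_refl \<open>C \<subseteq> U\<close>] by simp
        ultimately show "\<exists>w\<in>C. (w, u) \<in> (E \<inter> C \<times> C)\<^sup>* \<and>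
            (\<forall>p. simple_path E C p \<longrightarrow> hd p = w \<longrightarrow> length p \<le> h)"
          using \<open>w \<in> C\<close> by blast
      qed
      moreover have "eliminable E (U - C) h"
      proof (rule less.hyps)
        show "card (U - C) < card U"
          using \<open>w \<in> C\<close> w(1) less.prems(1) by (intro psubset_card_mono) auto
        show "finite (U - C)"
          using less.prems(1) by simp
        fix u assume u: "u \<in> U - C"
        then obtain x where x: "x \<in> U" "(x, u) \<in> R\<^sup>*"
            "\<And>p. simple_path E U p \<Longrightarrow> hd p = x \<Longrightarrow> length p \<le> h"
          using less.prems(2)[of u] unfolding R_def by blast
        from x(2) have "(x, u) \<in> (E \<inter> (U - C) \<times> (U - C))\<^sup>* \<and> x \<in> U - C"
        proof (induction rule: converse_rtrancl_induct)
          case (step y z)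
          then have "(y, z) \<in> E \<inter> (U - C) \<times> (U - C)"
            using R_closed[of y z] by (auto simp: R_def)
          then show ?case
            using step.IH by (auto intro: converse_rtrancl_into_rtrancl)
        qed (use u in simp)
        moreover have "length p \<le> h" if "simple_path E (U - C) p" "hd p = x" for p
          using x(3)[of p] that simple_path_mono[OF that(1) order_refl Diff_subset] by simp
        ultimately show "\<exists>w\<in>U - C. (w, u) \<in> (E \<inter> (U - C) \<times> (U - C))\<^sup>* \<and>
            (\<forall>p. simple_path E (U - C) p \<longrightarrow> hd p = w \<longrightarrow> length p \<le> h)"
          by blast
      qed
      moreover have no_edge: "v \<in> C" if "u \<in> C" "v \<in> U" "(u, v) \<in> E" for u v
        using that R_closed[of u v] \<open>C \<subseteq> U\<close> by (auto simp: R_def)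
      moreover have "(v, u) \<in> E" if "(u, v) \<in> E" for u v
        using that assms(2) by (simp add: symD)
      ultimately have "eliminable E (C \<union> (U - C)) h"
        by (intro eliminable.disjoint_union) blast+
      then show ?thesis
        using \<open>C \<subseteq> U\<close> by (simp add: Un_absorb1)
    qed
  qed (simp add: eliminable.empty)
qed

section \<open>Elimination along a linked layout\<close>

context finite_graph
begin

text \<open>
  The vertices that remain between positions \<open>s\<close> and \<open>t\<close> once both boundaries have been removed.
\<close>

definition piece :: "('a \<Rightarrow> nat) \<Rightarrow> nat \<Rightarrow> nat \<Rightarrow> 'a set" where
  "piece pos s t = below pos t - below pos s - bd (below pos t)"

text \<open>
  Vertices in both boundaries lie in every boundary in between. As they are removed
  together with the ends of the piece, they lower the price of all further cuts inside it.
\<close>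

definition common :: "('a \<Rightarrow> nat) \<Rightarrow> nat \<Rightarrow> nat \<Rightarrow> nat" where
  "common pos s t = card (bd (below pos s) \<inter> bd (below pos t))"

lemma bd_between:
  assumes "s \<le> x" "x \<le> t"
  shows "bd (below pos s) \<inter> bd (below pos t) \<subseteq> bd (below pos x)"
  using below_mono[OF assms(1), of pos] below_mono[OF assms(2), of pos]
  unfolding boundary_def by blast

lemma common_mono:
  assumes "s \<le> s'" "s' \<le> t'" "t' \<le> t"
  shows "common pos s t \<le> common pos s' t'"
  unfolding common_def using assms bd_between[of s s' t pos] bd_between[of s t' t pos]
  by (intro card_mono) auto

lemma common_le: 
  assumes "s \<le> x" "x \<le> t"
  shows "common pos s t \<le> card (bd (below pos x))"
  unfolding common_def using bd_between[OF assms] by (intro card_mono) auto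

lemma eliminable_cut:
  assumes x: "s \<le> x" "x \<le> t"
    and left: "eliminable E (piece pos s x) h" and right: "eliminable E (piece pos x t) h"
    and card: "card (bd (below pos x)) \<le> c + common pos s t"
  shows "eliminable E (piece pos s t) (h + c)"
proof -
  define X where "X = bd (below pos x) - bd (below pos s) \<inter> bd (below pos t)"
  have X: "finite X" "card X \<le> c"
    using card bd_between[OF x, of pos] by (auto simp: X_def common_def card_Diff_subset)
  define U W where "U = piece pos s t \<inter> below pos x - X" and "W = piece pos s t - below pos x - X"
  have U: "U \<subseteq> piece pos s x"
    by (auto simp: U_def X_def piece_def dest: subsetD[OF boundary_subset])
  have W: "W \<subseteq> piece pos x t"
    by (auto simp: W_def piece_def)
  have "E \<inter> U \<times> W = {}"
    using U by (auto simp: W_def piece_def boundary_def)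
  then have "eliminable E (U \<union> W) h"
    using eliminable_subset[OF left U] eliminable_subset[OF right W] sym_E
    by (intro eliminable.disjoint_union) (auto simp: U_def W_def sym_def)
  moreover have "U \<union> W = piece pos s t - X"
    by (auto simp: U_def W_def)
  ultimately have "eliminable E (piece pos s t) (h + card X)"
    using eliminable_remove_set[OF X(1)] by metis
  then show ?thesis
    by (rule eliminable_mono) (use X in simp)
qed

text \<open>
  Vertices of \<open>L\<close> in the boundary at \<open>y\<close> that were placed by position \<open>x\<close> are in the boundary at
  \<open>x\<close> as well. So if no vertex of \<open>L\<close> is placed between \<open>x\<close> and \<open>y\<close>, these vertices are common to
  the two ends.
\<close>

lemma common_if_constant:
  assumes "L \<subseteq> V" "x \<le> y" "{v \<in> L. x < pos v \<and> pos v \<le> y} = {}"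
  shows "card (L \<inter> bd (below pos y)) \<le> common pos x y"
  unfolding common_def
proof (rule card_mono)
  show "L \<inter> bd (below pos y) \<subseteq> bd (below pos x) \<inter> bd (below pos y)"
  proof
    fix v assume v: "v \<in> L \<inter> bd (below pos y)"
    then have "v \<in> L" "v \<in> V" "pos v \<le> y"
      by (auto simp: below_def boundary_def)
    then have "v \<in> below pos x"
      using assms(3) by (simp add: below_def) (metis not_le)
    then show "v \<in> bd (below pos x) \<inter> bd (below pos y)"
      using v below_mono[OF assms(2), of pos] unfolding boundary_def by blast
  qed
qed simp

text \<open>
  A binary search among the cheap positions, those satisfying \<open>cut\<close>, where a position \<open>x\<close> is
  weighted by the number of vertices of \<open>L\<close> placed between \<open>x\<close> and the right end \<open>y\<close>. Each of the
  \<open>Suc n\<close> rounds costs \<open>c\<close>, the price of a cheap boundary without the common part. What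
  remains are pieces without cheap positions and pieces on which \<open>L\<close> is constant.
  The weight counts from the first cheap position rather than from \<open>s\<close>: cutting at the last
  position \<open>x\<close> whose left part has weight less than half then halves both sides, since the right part
  is weighed from the next cheap position on.
\<close>

lemma eliminable_bisect:
  fixes cut :: "nat \<Rightarrow> bool" and h :: nat
  assumes L: "L \<subseteq> V" "\<And>l. i \<le> l \<Longrightarrow> l \<le> j \<Longrightarrow> m \<le> card (L \<inter> bd (below pos l))"
    and cut: "\<And>x. cut x \<Longrightarrow> card (bd (below pos x)) \<le> c + d"
    and no_cut: "\<And>s t. s0 \<le> s \<Longrightarrow> s \<le> t \<Longrightarrow> t \<le> j \<Longrightarrow> \<forall>x. s < x \<and> x < t \<longrightarrow> \<not> cut x \<Longrightarrow>
      eliminable E (piece pos s t) h"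
    and const: "\<And>s t. s0 \<le> s \<Longrightarrow> s \<le> t \<Longrightarrow> t \<le> j \<Longrightarrow> m \<le> common pos s t \<Longrightarrow>
      eliminable E (piece pos s t) h"
    and "s0 \<le> s" "s \<le> y" "i \<le> y" "y \<le> j" "d \<le> common pos s y"
    and "\<And>x. s < x \<Longrightarrow> cut x \<Longrightarrow> i \<le> x"
    and "\<And>x. s < x \<Longrightarrow> x < y \<Longrightarrow> cut x \<Longrightarrow> card {v \<in> L. x < pos v \<and> pos v \<le> y} < 2 ^ n"
  shows "eliminable E (piece pos s y) (h + Suc n * c)"
  using assms(6-)
proof (induction n arbitrary: s y)
  case 0
  show ?case
  proof (cases "\<exists>x. s < x \<and> x < y \<and> cut x")
    case False
    then show ?thesis
      using no_cut[of s y] 0 by (auto intro: eliminable_mono)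
  next
    case True
    define x where "x = (LEAST x. s < x \<and> x < y \<and> cut x)"
    have x: "s < x" "x < y" "cut x"
      using LeastI_ex[OF True] unfolding x_def by auto
    have least: "\<not> cut z" if "s < z" "z < x" for z
      using that not_less_Least[of z "\<lambda>x. s < x \<and> x < y \<and> cut x"] x(2) unfolding x_def[symmetric]
      by auto
    have "finite {v \<in> L. x < pos v \<and> pos v \<le> y}"
      using L(1) finite_V by (auto intro: finite_subset)
    then have "{v \<in> L. x < pos v \<and> pos v \<le> y} = {}"
      using 0(7)[OF x] by simp
    then have "m \<le> common pos x y"
      using common_if_constant[OF L(1), of x y pos] x L(2)[of y] 0 by simp
    then have "eliminable E (piece pos x y) h"
      using x 0 by (intro const) auto
    moreover have "eliminable E (piece pos s x) h"
      using x 0 least by (intro no_cut) auto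
    ultimately show ?thesis
      using eliminable_cut[of s x y pos h c] x cut[OF x(3)] 0(5) by simp
  qed
next
  case (Suc n)
  define w where "w x z = card {v \<in> L. x < pos v \<and> pos v \<le> z}" for x z
  have w_add: "w x z = w x y + w y z" if "x \<le> y" "y \<le> z" for x y z
  proof -
    have fin: "finite {v \<in> L. P v}" for P
      using L(1) finite_V by (auto intro: finite_subset)
    have "{v \<in> L. x < pos v \<and> pos v \<le> z}
        = {v \<in> L. x < pos v \<and> pos v \<le> y} \<union> {v \<in> L. y < pos v \<and> pos v \<le> z}"
      using that by auto
    then show ?thesis
      unfolding w_def using fin by (subst card_Un_disjoint[symmetric]) auto
  qed
  show ?case
  proof (cases "\<exists>x. s < x \<and> x < y \<and> cut x")
    case False
    then show ?thesis
      using no_cut[of s y] Suc.prems by (auto intro: eliminable_mono)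
  next
    case True
    \<comment> \<open>The position to cut at is the greatest \<open>light\<close> one: from every cheap position to the left of it,
      the weight up to it is less than half.\<close>
    define light where
      "light x \<longleftrightarrow> s < x \<and> x < y \<and> cut x \<and> (\<forall>z. s < z \<and> z < x \<and> cut z \<longrightarrow> w z x < 2 ^ n)" for x
    have "light (LEAST x. s < x \<and> x < y \<and> cut x)"
      unfolding light_def using LeastI_ex[OF True] not_less_Least by (metis (no_types, lifting) order_less_trans)
    moreover have bounded: "\<And>x. light x \<Longrightarrow> x \<le> y"
      by (simp add: light_def)
    ultimately obtain x where x: "light x" and greatest: "\<And>z. light z \<Longrightarrow> z \<le> x"
      using GreatestI_nat Greatest_le_nat by metis
    have x': "s < x" "x < y" "cut x"
      using x by (auto simp: light_def)
    have d: "d \<le> common pos s x" "d \<le> common pos x y"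
      using Suc.prems(5) common_mono[of s s x y pos] common_mono[of s x y y pos] x' by auto
    have "eliminable E (piece pos s x) (h + Suc n * c)"
      using x x' d Suc.prems by (intro Suc.IH) (auto simp: light_def w_def)
    moreover have "eliminable E (piece pos x y) (h + Suc n * c)"
    proof (rule Suc.IH)
      fix z assume z: "x < z" "z < y" "cut z"
      then have "\<not> light z"
        using greatest by (auto simp: not_le[symmetric])
      then obtain z' where z': "s < z'" "z' < z" "cut z'" "2 ^ n \<le> w z' z"
        using z x' unfolding light_def by auto
      have "w z' y < 2 ^ Suc n"
        using Suc.prems(7)[of z'] z' z unfolding w_def by auto
      then show "card {v \<in> L. z < pos v \<and> pos v \<le> y} < 2 ^ n"
        using w_add[of z' z y] z z' unfolding w_def by auto
    qed (use x' d Suc.prems in auto)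
    ultimately have "eliminable E (piece pos s y) (h + Suc n * c + c)"
      by (rule eliminable_cut[OF less_imp_le[OF x'(1)] less_imp_le[OF x'(2)]])
        (use cut[OF x'(3)] Suc.prems(5) in simp)
    then show ?thesis
      by (simp add: algebra_simps)
  qed
qed

text \<open>
  The potential \<open>2 * a - common - k\<close> pays for the elimination. Let \<open>m\<close> be the least boundary size
  inside the piece and \<open>d\<close> the number of common vertices. A cut costs at most \<open>2 * (m - d)\<close> if it is
  made at a boundary of size at most \<open>2 * (m - d) + d\<close>, and \<open>e + 2\<close> rounds of such cuts suffice: one at
  the last cheap position \<open>j\<close>, which makes all remaining cheap positions lie between the ends of a
  linkage of \<open>m\<close> paths, and \<open>e + 1\<close> for the binary search. Afterwards either \<open>m\<close> vertices are common to both ends or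
  all boundaries inside exceed \<open>2 * m - d\<close>. In both cases the sum of \<open>common\<close> and the new lower
  bound is at least \<open>2 * m\<close>, where before it was \<open>d + m\<close>; this gain of \<open>m - d\<close> is what the
  cuts are charged to.
\<close>

lemma eliminable_piece:
  assumes layout: "layout a pos" and linked: "linked pos"
    and short: "\<And>p. simple_path E V p \<Longrightarrow> length p \<le> n" and n: "a * n < 2 ^ e"
  shows "s \<le> t \<Longrightarrow> \<forall>x. s < x \<and> x < t \<longrightarrow> k \<le> card (bd (below pos x)) \<Longrightarrow>
    eliminable E (piece pos s t) (2 * (e + 2) * (2 * a - common pos s t - k) + 1)"
proof (induction "t - s" arbitrary: s t k rule: less_induct)
  case less
  let ?M = "2 * (e + 2)"
  let ?b = "\<lambda>x. card (bd (below pos x))"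
  define d where "d = common pos s t"
  show ?case
  proof (cases "\<exists>x. s < x \<and> x < t")
    case False
    have "finite (piece pos s t)"
      by (auto simp: piece_def)
    moreover have "u = v" if "u \<in> piece pos s t" "v \<in> piece pos s t" for u v
      using that False layout unfolding piece_def below_def layout_def
      by (auto dest!: inj_onD[of pos V u v])
    ultimately have "card (piece pos s t) \<le> 1"
      by (auto simp: card_le_Suc0_iff_eq)
    moreover have "eliminable E (piece pos s t) (0 + card (piece pos s t))"
      using \<open>finite (piece pos s t)\<close>
      by (intro eliminable_remove_set) (auto intro: eliminable.empty)
    ultimately show ?thesis
      by (auto intro: eliminable_mono)
  next
    case True
    define m where "m = Min (?b ` {s<..<t})"
    have m_le: "m \<le> ?b x" if "s < x" "x < t" for x
      using that unfolding m_def by (intro Min_le) auto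
    have "m \<in> ?b ` {s<..<t}"
      unfolding m_def using True by (intro Min_in) auto
    then obtain x0 where x0: "s < x0" "x0 < t" "m = ?b x0"
      by auto
    have bounds: "k \<le> m" "d \<le> m" "m \<le> a"
      using x0 less.prems(2) common_le[of s x0 t pos] layout_card_le[OF layout, of x0] by (auto simp: d_def)
    define cut where "cut x \<longleftrightarrow> s < x \<and> x < t \<and> ?b x \<le> 2 * (m - d) + d" for x
    have x0_cut: "cut x0"
      using x0 bounds by (auto simp: cut_def)
    define i where "i = (LEAST x. cut x)"
    have i: "cut i" "\<And>x. cut x \<Longrightarrow> i \<le> x"
      unfolding i_def using x0_cut by (auto intro: LeastI Least_le)
    have cut_le: "\<And>x. cut x \<Longrightarrow> x \<le> t"
      by (simp add: cut_def)
    then obtain j where j: "cut j" "\<And>x. cut x \<Longrightarrow> x \<le> j"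
      using GreatestI_nat[of cut, OF x0_cut] Greatest_le_nat[of cut] by metis
    have ij: "i \<le> j" "s < i" "j < t"
      using i j by (auto simp: cut_def)
    define h where "h = ?M * (2 * a - 2 * m) + 1"
    \<comment> \<open>The summand \<open>d\<close> of \<open>2 * (m - d) + d\<close> is matched by the at least \<open>d\<close> common vertices.\<close>
    have no_cut: "eliminable E (piece pos s' t') h"
      if st: "s \<le> s'" "s' \<le> t'" "t' \<le> t" "t' - s' < t - s" "\<forall>x. s' < x \<and> x < t' \<longrightarrow> \<not> cut x" for s' t'
    proof -
      have "eliminable E (piece pos s' t') (?M * (2 * a - common pos s' t' - (2 * (m - d) + d)) + 1)"
        using st by (intro less.hyps) (auto simp: cut_def)
      moreover have "2 * a - common pos s' t' - (2 * (m - d) + d) \<le> 2 * a - 2 * m"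
        using common_mono[of s s' t' t pos] st bounds by (auto simp: d_def)
      ultimately show ?thesis
        unfolding h_def by (blast intro: eliminable_mono add_le_mono1 mult_le_mono2)
    qed
    have const: "eliminable E (piece pos s' t') h"
      if st: "s \<le> s'" "s' \<le> t'" "t' \<le> t" "t' - s' < t - s" "m \<le> common pos s' t'" for s' t'
    proof -
      have "eliminable E (piece pos s' t') (?M * (2 * a - common pos s' t' - m) + 1)"
        using st m_le by (intro less.hyps) auto
      moreover have "2 * a - common pos s' t' - m \<le> 2 * a - 2 * m"
        using st by auto
      ultimately show ?thesis
        unfolding h_def by (blast intro: eliminable_mono add_le_mono1 mult_le_mono2)
    qed
    obtain L where L: "L \<subseteq> V" "card L \<le> m * n" "\<And>l. l \<in> {i..j} \<Longrightarrow> m \<le> card (L \<inter> bd (below pos l))"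
      using linkage_exists[OF linked ij(1) m_le short] ij by force
    have card_L: "card L < 2 ^ e"
      using L(2) mult_le_mono1[OF bounds(3), of n] n by linarith
    have left: "eliminable E (piece pos s j) (h + Suc e * (2 * (m - d)))"
    proof (rule eliminable_bisect[where cut = cut and L = L and i = i and j = j and m = m and d = d and ?s0.0 = s])
      show "d \<le> common pos s j"
        unfolding d_def using ij by (intro common_mono) auto
      fix x
      have "card {v \<in> L. x < pos v \<and> pos v \<le> j} \<le> card L"
        using L(1) finite_V by (intro card_mono) (auto intro: finite_subset)
      then show "card {v \<in> L. x < pos v \<and> pos v \<le> j} < 2 ^ e"
        using card_L by simp
    qed (use L ij i no_cut const in \<open>auto simp: cut_def\<close>)
    have right: "eliminable E (piece pos j t) h"
      using ij j by (intro no_cut) (auto simp: not_le[symmetric])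
    have "eliminable E (piece pos s t) (h + Suc e * (2 * (m - d)) + 2 * (m - d))"
      using ij j(1) by (intro eliminable_cut[OF _ _ left eliminable_mono[OF right]])
        (auto simp: cut_def d_def)
    moreover have "h + Suc e * (2 * (m - d)) + 2 * (m - d) \<le> ?M * (2 * a - d - k) + 1"
    proof -
      have "h + Suc e * (2 * (m - d)) + 2 * (m - d) = ?M * ((2 * a - 2 * m) + (m - d)) + 1"
      proof -
        have "?M * x + 1 + Suc e * (2 * y) + 2 * y = ?M * (x + y) + 1" for x y
          by (simp add: algebra_simps)
        then show ?thesis
          unfolding h_def by blast
      qed
      also have "\<dots> \<le> ?M * (2 * a - d - k) + 1"
        using bounds by (intro add_le_mono1 mult_le_mono2) linarith
      finally show ?thesis .
    qed
    ultimately show ?thesis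
      unfolding d_def by (rule eliminable_mono)
  qed
qed

lemma eliminable_if_layout:
  assumes "layout a pos"
    and "\<And>p. simple_path E V p \<Longrightarrow> length p \<le> n" and "a * n < 2 ^ e"
  shows "eliminable E V (4 * a * (e + 2) + 1)"
proof -
  obtain pos where pos: "layout a pos" "linked pos"
    using linked_layout_exists[OF assms(1)] by auto
  define t where "t = Max (insert 0 (pos ` V))"
  have t: "pos v \<le> t" if "v \<in> V" for v
    using that finite_V unfolding t_def by (intro Max_ge) auto
  have ends: "below pos 0 = {}" "below pos t = V"
    using pos(1) t by (auto simp: below_def layout_def)
  moreover have "bd V = {}"
    using E_subset by (auto simp: boundary_def)
  ultimately have "piece pos 0 t = V"
    by (simp add: piece_def)
  moreover have "common pos 0 t = 0"
    using ends by (simp add: common_def boundary_def)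
  ultimately show ?thesis
    using eliminable_piece[OF pos assms(2,3), of 0 t 0] by (simp add: algebra_simps)
qed

end

section \<open>Elimination forests\<close>

text \<open>
  A rooted forest on \<open>U\<close> encoded by the path \<open>r v\<close> from a root to each vertex \<open>v\<close>: the paths are
  closed under prefixes, and \<open>u\<close> is an ancestor of \<open>v\<close> iff it lies on \<open>r v\<close>. Adding a root in front
  of all paths and uniting two forests are immediate in this form.
\<close>

definition root_paths :: "('a \<times> 'a) set \<Rightarrow> 'a set \<Rightarrow> nat \<Rightarrow> ('a \<Rightarrow> 'a list) \<Rightarrow> bool" where
  "root_paths E U h r \<longleftrightarrow>
     (\<forall>v\<in>U. r v \<noteq> [] \<and> last (r v) = v \<and> set (r v) \<subseteq> U \<and> length (r v) \<le> h \<and>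
       (\<forall>xs w ys. r v = xs @ w # ys \<longrightarrow> r w = xs @ [w])) \<and>
     (\<forall>(u, v)\<in>E. u \<in> U \<longrightarrow> v \<in> U \<longrightarrow> u \<in> set (r v) \<or> v \<in> set (r u))"

lemma eliminable_root_paths:
  "eliminable E U h \<Longrightarrow> \<exists>r. root_paths E U h r"
proof (induction rule: eliminable.induct)
  case (empty h)
  then show ?case
    by (simp add: root_paths_def)
next
  case (remove v U h)
  then obtain r where r: "root_paths E (U - {v}) h r"
    by auto
  define r' where "r' u = (if u = v then [v] else v # r u)" for u
  have "r' w = xs @ [w]" if u: "u \<in> U" and eq: "r' u = xs @ w # ys" for u xs w ys
  proof (cases "u = v \<or> xs = []")
    case True
    then have "xs = []" "w = v"
      using eq by (auto simp: r'_def Cons_eq_append_conv split: if_splits)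
    then show ?thesis
      by (simp add: r'_def)
  next
    case False
    then obtain xs' where xs': "xs = v # xs'" "r u = xs' @ w # ys"
      using eq by (auto simp: r'_def Cons_eq_append_conv)
    moreover have "w \<in> set (r u)"
      using xs' by simp
    ultimately have "r w = xs' @ [w]" "w \<noteq> v"
      using r u False unfolding root_paths_def by blast+
    then show ?thesis
      using xs' by (simp add: r'_def)
  qed
  moreover have "r' u \<noteq> [] \<and> last (r' u) = u \<and> set (r' u) \<subseteq> U \<and> length (r' u) \<le> Suc h"
    if u: "u \<in> U" for u
  proof (cases "u = v")
    case False
    then have "r u \<noteq> [] \<and> last (r u) = u \<and> set (r u) \<subseteq> U - {v} \<and> length (r u) \<le> h"
      using r u unfolding root_paths_def by blast
    then show ?thesis
      using False u remove.hyps(1) by (auto simp: r'_def)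
  qed (use u in \<open>simp add: r'_def\<close>)
  moreover have "u \<in> set (r' w) \<or> w \<in> set (r' u)" if e: "(u, w) \<in> E" "u \<in> U" "w \<in> U" for u w
  proof (cases "u = v \<or> w = v")
    case False
    then have "u \<in> set (r w) \<or> w \<in> set (r u)"
      using r e unfolding root_paths_def by blast
    then show ?thesis
      using False by (auto simp: r'_def)
  qed (auto simp: r'_def)
  ultimately have "root_paths E U (Suc h) r'"
    unfolding root_paths_def by blast
  then show ?case
    by blast
next
  case (disjoint_union U h W)
  then obtain r s where r: "root_paths E U h r" and s: "root_paths E W h s"
    by auto
  define r' where "r' u = (if u \<in> U then r u else s u)" for u
  have r': "r' u = r u" if "u \<in> U" for u
    using that by (simp add: r'_def)
  have s': "r' u = s u" if "u \<in> W" for u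
    using that disjoint_union.hyps by (auto simp: r'_def)
  have "r' w = xs @ [w]" if u: "u \<in> U \<union> W" and eq: "r' u = xs @ w # ys" for u xs w ys
  proof -
    have "w \<in> set (r' u)"
      using eq by simp
    then show ?thesis
      using u
    proof (elim UnE)
      assume "w \<in> set (r' u)" "u \<in> U"
      then have "w \<in> U" "r w = xs @ [w]"
        using r eq unfolding root_paths_def r'[OF \<open>u \<in> U\<close>] by blast+
      then show ?thesis
        by (simp add: r')
    next
      assume "w \<in> set (r' u)" "u \<in> W"
      then have "w \<in> W" "s w = xs @ [w]"
        using s eq unfolding root_paths_def s'[OF \<open>u \<in> W\<close>] by blast+
      then show ?thesis
        by (simp add: s')
    qed
  qed
  moreover have "r' u \<noteq> [] \<and> last (r' u) = u \<and> set (r' u) \<subseteq> U \<union> W \<and> length (r' u) \<le> h"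
    if "u \<in> U \<union> W" for u
    using that
  proof
    assume u: "u \<in> U"
    show ?thesis
      using r u unfolding root_paths_def r'[OF u] by blast
  next
    assume u: "u \<in> W"
    show ?thesis
      using s u unfolding root_paths_def s'[OF u] by blast
  qed
  moreover have "u \<in> set (r' w) \<or> w \<in> set (r' u)"
    if e: "(u, w) \<in> E" "u \<in> U \<union> W" "w \<in> U \<union> W" for u w
  proof -
    consider "u \<in> U" "w \<in> U" | "u \<in> W" "w \<in> W"
      using e disjoint_union.hyps by blast
    then show ?thesis
    proof cases
      case 1
      then show ?thesis
        using r e(1) unfolding root_paths_def r'[OF 1(1)] r'[OF 1(2)] by blast
    next
      case 2
      then show ?thesis
        using s e(1) unfolding root_paths_def s'[OF 2(1)] s'[OF 2(2)] by blast
    qed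
  qed
  ultimately have "root_paths E (U \<union> W) h r'"
    unfolding root_paths_def by blast
  then show ?case
    by blast
qed

definition root_path_forest :: "'a set \<Rightarrow> ('a \<Rightarrow> 'a list) \<Rightarrow> 'a pair_pre_digraph" where
  "root_path_forest U r =
     \<lparr>pverts = U, parcs = {(u, v). u \<in> U \<and> v \<in> U \<and> r v = r u @ [v]}\<rparr>"

context
  fixes E :: "('a \<times> 'a) set" and U h r
  assumes fin: "finite U" and r: "root_paths E U h r"
begin

lemma root_paths_facts:
  assumes "v \<in> U"
  shows "r v \<noteq> []" "last (r v) = v" "set (r v) \<subseteq> U" "length (r v) \<le> h"
    "r v = xs @ w # ys \<Longrightarrow> r w = xs @ [w]"
  using r assms unfolding root_paths_def by blast+

lemma distinct_root_path: "v \<in> U \<Longrightarrow> distinct (r v)"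
proof (rule ccontr)
  assume v: "v \<in> U" "\<not> distinct (r v)"
  then obtain xs ys zs w where eq: "r v = xs @ [w] @ ys @ [w] @ zs"
    using not_distinct_decomp by blast
  have "r w = xs @ [w]"
    using root_paths_facts(5)[OF v(1), of xs w] eq by simp
  moreover have "r w = (xs @ w # ys) @ [w]"
    using root_paths_facts(5)[OF v(1), of "xs @ w # ys" w zs] eq by simp
  ultimately show False
    by simp
qed

lemma forest_simps [simp]:
  "pverts (root_path_forest U r) = U"
  "(u, v) \<in> parcs (root_path_forest U r) \<longleftrightarrow> u \<in> U \<and> v \<in> U \<and> r v = r u @ [v]"
  by (auto simp: root_path_forest_def)

lemma rooted_forest_root_path_forest: "rooted_forest (root_path_forest U r)"
  unfolding rooted_forest_def
proof (intro conjI ballI)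
  have "parcs (root_path_forest U r) \<subseteq> U \<times> U"
    by auto
  then show "pair_fin_digraph (root_path_forest U r)"
    using fin by unfold_locales (auto intro: finite_subset)
  have "parcs (root_path_forest U r) \<subseteq> measure (\<lambda>v. length (r v))"
    by auto
  then show "acyclic (parcs (root_path_forest U r))"
    by (meson acyclic_subset wf_acyclic wf_measure)
  fix v
  have "in_arcs (with_proj (root_path_forest U r)) v \<subseteq> {(last (butlast (r v)), v)}"
    using root_paths_facts(2) by (auto simp: in_arcs_def)
  then show "in_degree (with_proj (root_path_forest U r)) v \<le> 1"
    using card_mono[of "{(last (butlast (r v)), v)}"] unfolding in_degree_def by force
qed

lemma root_forest_iff: "root (root_path_forest U r) v \<longleftrightarrow> v \<in> U \<and> r v = [v]"
proof -
  let ?A = "in_arcs (with_proj (root_path_forest U r)) v"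
  have "finite ?A"
    by (rule finite_subset[of _ "U \<times> U"]) (auto simp: in_arcs_def fin)
  then have "root (root_path_forest U r) v \<longleftrightarrow> v \<in> U \<and> ?A = {}"
    by (simp add: root_def in_degree_def)
  also have "\<dots> \<longleftrightarrow> v \<in> U \<and> r v = [v]"
  proof (intro conj_cong refl)
    assume v: "v \<in> U"
    obtain xs where xs: "r v = xs @ [v]"
      using root_paths_facts(1,2)[OF v] by (metis append_butlast_last_id)
    show "?A = {} \<longleftrightarrow> r v = [v]"
    proof (cases xs rule: rev_cases)
      case Nil
      then show ?thesis
        using xs root_paths_facts(1) by (auto simp: in_arcs_def)
    next
      case (snoc ys u)
      then have "r u = xs" "u \<in> U"
        using root_paths_facts(3,5)[OF v] xs by auto
      then have "(u, v) \<in> ?A"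
        using v xs by (simp add: in_arcs_def)
      then have "?A \<noteq> {}"
        by blast
      then show ?thesis
        using snoc xs by simp
    qed
  qed
  finally show ?thesis .
qed

lemma root_path_forest_root_path: "v \<in> U \<Longrightarrow> root_path (root_path_forest U r) (r v) v"
proof -
  have arcs: "set (vwalk_arcs (r v)) \<subseteq> parcs (root_path_forest U r)" if "v \<in> U" for v
    using that
  proof (induction "length (r v)" arbitrary: v rule: less_induct)
    case less
    obtain xs where xs: "r v = xs @ [v]"
      using root_paths_facts(1,2)[OF less.prems] by (metis append_butlast_last_id)
    show ?case
    proof (cases xs rule: rev_cases)
      case Nil
      then show ?thesis
        using xs by simp
    next
      case (snoc ys u)
      then have "r u = xs" "u \<in> U"
        using root_paths_facts(3,5)[OF less.prems] xs by auto
      then show ?thesis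
        using less.hyps[of u] less.prems xs snoc vwalk_arcs_append[of xs "[v]"] by simp
    qed
  qed
  assume v: "v \<in> U"
  obtain w ws where "r v = w # ws"
    using root_paths_facts(1)[OF v] by (cases "r v") auto
  then have "root (root_path_forest U r) (hd (r v))"
    using root_paths_facts(3)[OF v] root_paths_facts(5)[OF v, of "[]" w ws] by (simp add: root_forest_iff)
  then show ?thesis
    using v arcs[OF v] root_paths_facts(1-3)[OF v] distinct_root_path[OF v]
    by (simp add: root_path_def vpath_def vwalk_def)
qed

lemma root_path_unique:
  assumes "root_path (root_path_forest U r) p v"
  shows "v \<in> U \<and> p = r v"
proof -
  have p: "p \<noteq> []" "set p \<subseteq> U" "set (vwalk_arcs p) \<subseteq> parcs (root_path_forest U r)"
      "r (hd p) = [hd p]" "last p = v"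
    using assms by (auto simp: root_path_def vpath_def vwalk_def root_forest_iff)
  have "p = r (last p)"
    using p(1,3,4)
  proof (induction p rule: rev_induct)
    case (snoc x p)
    show ?case
    proof (cases "p = []")
      case True
      then show ?thesis
        using snoc by simp
    next
      case False
      then show ?thesis
        using snoc by (simp add: vwalk_arcs_append)
    qed
  qed simp
  then show ?thesis
    using p last_in_set[OF p(1)] by (metis subsetD)
qed

lemma height_root_path_forest: "height (root_path_forest U r) \<le> h"
proof -
  let ?L = "{length p | p v. root_path (root_path_forest U r) p v \<and> leaf (root_path_forest U r) v}"
  have le: "n \<le> h" if "n \<in> ?L" for n
    using that root_path_unique root_paths_facts(4) by blast
  show ?thesis
  proof (cases "?L = {}")
    case True
    show ?thesis
      unfolding height_def True by simp
  next
    case False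
    show ?thesis
      unfolding height_def by (rule cSup_least[OF False le])
  qed
qed

end

lemma treedepth_le_if_eliminable:
  assumes "finite (verts G)" "arcs_ends G \<subseteq> verts G \<times> verts G"
    and "eliminable (arcs_ends G) (verts G) h"
  shows "treedepth G \<le> h"
proof -
  obtain r where r: "root_paths (arcs_ends G) (verts G) h r"
    using eliminable_root_paths[OF assms(3)] by auto
  let ?F = "root_path_forest (verts G) r"
  have "ancestor ?F u v \<or> ancestor ?F v u" if "(u, v) \<in> arcs_ends G" for u v
  proof -
    have "u \<in> verts G" "v \<in> verts G" "u \<in> set (r v) \<or> v \<in> set (r u)"
      using that assms(2) r by (auto simp: root_paths_def)
    then show ?thesis
      using root_path_forest_root_path[OF assms(1) r] unfolding ancestor_def by blast
  qed
  then have "elimination_forest G ?F"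
    using rooted_forest_root_path_forest[OF assms(1) r]
    by (auto simp: elimination_forest_def root_path_forest_def)
  then have "treedepth G \<le> height ?F"
    unfolding treedepth_def by (intro Least_le) auto
  also have "\<dots> \<le> h"
    by (rule height_root_path_forest[OF assms(1) r])
  finally show ?thesis .
qed

section \<open>From path decompositions to layouts\<close>

text \<open>
  The minimum that defines the pathwidth is attained: a single bag is a decomposition, and widths are
  natural numbers shifted by one.
\<close>

lemma pathwidth_decomposition:
  assumes "arcs_ends G \<subseteq> verts G \<times> verts G"
  shows "\<exists>Bs. path_decomposition G Bs \<and> width Bs = pathwidth G"
proof -
  define P where "P Bs \<longleftrightarrow> path_decomposition G Bs" for Bs
  define size where "size Bs = Max (card ` set Bs)" for Bs :: "'a set list"
  have "P [verts G]"
    using assms by (auto simp: P_def path_decomposition_def)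
  then obtain Bs where Bs: "P Bs" "\<And>Cs. P Cs \<Longrightarrow> size Bs \<le> size Cs"
    using ex_has_least_nat[of P "[verts G]" size] by auto
  have "pathwidth G = width Bs"
    unfolding pathwidth_def
  proof (rule Least_equality)
    show "\<exists>Cs. path_decomposition G Cs \<and> width Cs = width Bs"
      using Bs(1) by (auto simp: P_def)
  next
    fix w assume "\<exists>Cs. path_decomposition G Cs \<and> width Cs = w"
    then obtain Cs where "P Cs" "w = width Cs"
      by (auto simp: P_def)
    then show "width Bs \<le> w"
      using Bs(2)[of Cs] by (simp add: size_def width_def)
  qed
  then show ?thesis
    using Bs(1) by (auto simp: P_def)
qed

text \<open>
  The vertices are ordered by their first bags. When \<open>v\<close> is placed, each boundary vertex \<open>u\<close> has
  started by the first bag of \<open>v\<close> and shares a bag with a vertex that starts no earlier than \<open>v\<close>;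
  hence \<open>u\<close> lies in the first bag of \<open>v\<close>. So the boundary is contained in a bag.
\<close>

lemma layout_if_path_decomposition:
  fixes G :: "('a, 'b) pre_digraph"
  assumes fin: "finite (verts G)" and wf: "arcs_ends G \<subseteq> verts G \<times> verts G" and sym: "sym (arcs_ends G)"
    and Bs: "path_decomposition G Bs" and a: "\<And>B. B \<in> set Bs \<Longrightarrow> card B \<le> a"
  shows "\<exists>pos. finite_graph.layout (arcs_ends G) (verts G) a pos"
proof -
  interpret finite_graph "arcs_ends G" "verts G"
    using fin wf sym by unfold_locales
  define first where "first v = (LEAST t. t < length Bs \<and> v \<in> Bs ! t)" for v
  have interval: "\<exists>i j. i \<le> j \<and> j < length Bs \<and> {t. t < length Bs \<and> v \<in> Bs ! t} = {i..j}"
    if "v \<in> verts G" for v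
    using Bs that by (simp add: path_decomposition_def)
  have first: "first v < length Bs" "v \<in> Bs ! first v" if v: "v \<in> verts G" for v
  proof -
    obtain i j where ij: "i \<le> j" "{t. t < length Bs \<and> v \<in> Bs ! t} = {i..j}"
      using interval[OF v] by blast
    then have "i \<in> {t. t < length Bs \<and> v \<in> Bs ! t}"
      by simp
    then have "\<exists>t. t < length Bs \<and> v \<in> Bs ! t"
      by blast
    then show "first v < length Bs" "v \<in> Bs ! first v"
      unfolding first_def by (metis (mono_tags, lifting) LeastI_ex)+
  qed
  have first_le: "first v \<le> t" if "t < length Bs" "v \<in> Bs ! t" for v t
    unfolding first_def using that by (intro Least_le) simp
  have convex: "v \<in> Bs ! t" if v: "v \<in> verts G" and "first v \<le> t" "t \<le> s" "s < length Bs" "v \<in> Bs ! s" for v s t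
  proof -
    obtain i j where ij: "{t. t < length Bs \<and> v \<in> Bs ! t} = {i..j}"
      using interval[OF v] by blast
    have "first v \<in> {i..j}" "s \<in> {i..j}"
      using first[OF v] that unfolding ij[symmetric] by auto
    then have "t \<in> {i..j}"
      using that by auto
    then show ?thesis
      unfolding ij[symmetric] by simp
  qed
  define n where "n = card (verts G)"
  obtain f where f: "bij_betw f (verts G) {0..<n}"
    using ex_bij_betw_finite_nat[OF fin] unfolding n_def by blast
  have f_less: "f v < n" if "v \<in> verts G" for v
    using bij_betwE[OF f] that by simp
  \<comment> \<open>Ties between vertices with the same first bag are broken by \<open>f\<close>; the successor makes positions positive.\<close>
  define pos where "pos v = Suc (first v * n + f v)" for v
  have first_mono: "first u \<le> first v" if "pos u \<le> pos v" "u \<in> verts G" "v \<in> verts G" for u v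
  proof -
    have "(first u * n + f u) div n \<le> (first v * n + f v) div n"
      using that by (intro div_le_mono) (simp add: pos_def)
    moreover have "(x * n + f w) div n = x" if "w \<in> verts G" for x w
      using f_less[OF that] by simp
    ultimately show ?thesis
      using that by simp
  qed
  have "inj_on pos (verts G)"
  proof (rule inj_onI)
    fix u v assume uv: "u \<in> verts G" "v \<in> verts G" "pos u = pos v"
    then have "first u = first v"
      using first_mono by (metis antisym order_refl)
    then show "u = v"
      using uv inj_onD[OF bij_betw_imp_inj_on[OF f], of u v] by (simp add: pos_def)
  qed
  moreover have "card (bd (below pos (pos v))) \<le> a" if v: "v \<in> verts G" for v
  proof -
    have "bd (below pos (pos v)) \<subseteq> Bs ! first v"
    proof
      fix u assume "u \<in> bd (below pos (pos v))"
      then obtain w where u: "u \<in> verts G" "pos u \<le> pos v" and w: "(u, w) \<in> arcs_ends G" "w \<in> verts G" "pos v \<le> pos w"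
        using wf by (auto simp: boundary_def below_def)
      obtain B where B: "B \<in> set Bs" "u \<in> B" "w \<in> B"
        using Bs w(1) by (auto simp: path_decomposition_def)
      then obtain s where s: "s < length Bs" "u \<in> Bs ! s" "w \<in> Bs ! s"
        by (metis in_set_conv_nth)
      show "u \<in> Bs ! first v"
        using convex[OF u(1) first_mono[OF u(2,1) v] _ s(1,2)] first_mono[OF w(3) v w(2)] first_le[OF s(1,3)]
        by simp
    qed
    moreover have "Bs ! first v \<in> set Bs"
      using first[OF v] by simp
    moreover have "finite (Bs ! first v)"
      using Bs fin calculation(2) by (auto simp: path_decomposition_def intro: finite_subset)
    ultimately show ?thesis
      using a card_mono le_trans by metis
  qed
  ultimately have "layout a pos"
    by (simp add: layout_def pos_def)
  then show ?thesis
    by blast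
qed

section \<open>Treedepth, pathwidth and long paths\<close>

lemma successively_vwalk_arcs:
  "set (vwalk_arcs p) \<subseteq> E \<longleftrightarrow> successively (\<lambda>u v. (u, v) \<in> E) p"
  by (induction p rule: vwalk_arcs.induct) auto

lemma simple_path_iff_vpath: "simple_path (arcs_ends G) (verts G) p \<longleftrightarrow> vpath p G"
  by (auto simp: simple_path_def vpath_def vwalk_def successively_vwalk_arcs)

lemma simple_path_take:
  "simple_path E V p \<Longrightarrow> 0 < n \<Longrightarrow> simple_path E V (take n p)"
  unfolding simple_path_def
  by (metis append_take_drop_id distinct_take order_trans set_take_subset successively_append_iff take_eq_Nil less_irrefl)

theorem theorem3:
  fixes G :: "('a, 'b) pre_digraph" and a b :: nat
  assumes "a > 0" and "b > 0"
    and "graph G"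
    and "pathwidth G < int a"
    and "\<not> (\<exists>p. vpath p G \<and> length p = 2 ^ b)"
  shows "treedepth G \<le> 10 * a * b"
proof -
  interpret graph G
    by fact
  have wf: "arcs_ends G \<subseteq> verts G \<times> verts G"
    by (auto simp: arcs_ends_conv)
  have sym: "sym (arcs_ends G)"
    using sym_arcs by (simp add: symmetric_def)
  interpret finite_graph "arcs_ends G" "verts G"
    using finite_verts wf sym by unfold_locales
  have short: "length p \<le> 2 ^ b - 1" if "simple_path (arcs_ends G) (verts G) p" for p
  proof (rule ccontr)
    assume "\<not> length p \<le> 2 ^ b - 1"
    then have "2 ^ b \<le> length p"
      by linarith
    then have "vpath (take (2 ^ b) p) G" "length (take (2 ^ b) p) = 2 ^ b"
      using simple_path_take[OF that, of "2 ^ b"] by (simp_all add: simple_path_iff_vpath)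
    then show False
      using assms(5) by blast
  qed
  \<comment> \<open>If \<open>a\<close> is so large that \<open>10 * a * b\<close> reaches \<open>2 ^ b\<close>, the path bound alone suffices. Otherwise
    \<open>log a\<close> is less than \<open>b\<close>, and the bound \<open>O(a * (b + log a))\<close> from layouts is good enough.\<close>
  have "eliminable (arcs_ends G) (verts G) (10 * a * b)"
  proof (cases "2 ^ b \<le> 10 * a * b")
    case True
    have "eliminable (arcs_ends G) (verts G) (2 ^ b - 1)"
      using short by (intro eliminable_if_no_long_path finite_verts sym) blast
    then show ?thesis
      by (rule eliminable_mono) (use True in simp)
  next
    case False
    obtain Bs where Bs: "path_decomposition G Bs" "width Bs < int a"
      using pathwidth_decomposition[OF wf] assms(4) by auto
    have "card B \<le> a" if "B \<in> set Bs" for B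
    proof -
      have "card B \<le> Max (card ` set Bs)"
        using that by (intro Max_ge) auto
      then show ?thesis
        using Bs(2) by (simp add: width_def)
    qed
    then obtain pos where pos: "layout a pos"
      using layout_if_path_decomposition[OF finite_verts wf sym Bs(1)] by blast
    have "10 * a \<le> 10 * a * b"
      using assms(2) by simp
    then have a: "8 * a < 2 ^ b"
      using False by linarith
    then have "(2::nat) ^ 3 < 2 ^ b"
      using assms(1) by (simp add: order_le_less_trans[of 8 "8 * a"])
    then have b: "3 < b"
      by (simp only: power_strict_increasing_iff)
    \<comment> \<open>Linkages have fewer than \<open>a * 2 ^ b\<close> vertices, and \<open>8 * a < 2 ^ b\<close>, so \<open>2 * b - 3\<close> halvings exhaust them.\<close>
    define e where "e = 2 * b - 3"
    have "8 * (a * (2 ^ b - 1)) \<le> 8 * a * 2 ^ b"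
      by simp
    also have "\<dots> < 2 ^ b * 2 ^ b"
      using a by simp
    also have "\<dots> = 2 ^ (3 + e)"
      unfolding power_add[symmetric] e_def using b by simp
    also have "\<dots> = 8 * 2 ^ e"
      by (simp add: power_add)
    finally have "a * (2 ^ b - 1) < 2 ^ e"
      by simp
    then have "eliminable (arcs_ends G) (verts G) (4 * a * (e + 2) + 1)"
      using eliminable_if_layout[OF pos short] by blast
    moreover have "4 * a * (e + 2) + 1 \<le> 10 * a * b"
    proof -
      have "4 * a * (e + 2) + 1 \<le> 4 * a * (e + 2) + 4 * a"
        using assms(1) by simp
      also have "\<dots> = 4 * a * (e + 3)"
        by (simp add: algebra_simps)
      also have "e + 3 = 2 * b"
        using b by (simp add: e_def)
      finally show ?thesis
        by simp
    qed
    ultimately show ?thesis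
      by (rule eliminable_mono)
  qed
  then show ?thesis
    by (rule treedepth_le_if_eliminable[OF finite_verts wf])
qed

end
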